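(* Let $\widehat{X}$ be a sink-distance-regular directed graph with parameters $d$, $\{a_i\}_{i=1}^d$, $\{b_i\}_{i=1}^d$, $\{c_i\}_{i=1}^d$. Define $n_{d+1}=0$, $$n_d=\left\lfloor\frac{\deg^{+}(\Gamma_d)-1}{c_d}\right\rfloor,\qquad n_i=\left\lfloor\frac{\deg^{+}(\Gamma_i)-1+n_{i+1}b_i}{c_i}\right\rfloor\ (1\le i<d).$$ Then the identity element of the sandpile group $\mathcal{G}(\widehat{X})$ is the configuration $$e=\sum_{i=1}^d (n_ic_i-n_{i+1}b_i)\,\gamma_i.$$
   Context: Let $\widehat X$ be a finite weakly connected directed multigraph (loops and multiple edges allowed) with a distinguished sink vertex $s$ reachable from all vertices and at least one non-sink vertex. A configuration assigns a nonnegative integer number of grains to each non-sink vertex; it is stable if every $v$ holds fewer than $\deg^{+}(v)$ (out-degree) grains; toppling an unstable vertex sends one grain along each out-edge (grains reaching the sink vanish; the sink never topples); every configuration has a unique stabilization. The sandpile monoid $\mathcal M(\widehat X)$ is the set of stable configurations with $a\oplus b$ = stabilization of $a+b$, and the sandpile group $\mathcal G(\widehat X)$ is its minimal ideal, which is a group. For vertices $x,y$, $\delta(x,y)$ is the length of a shortest directed path from $x$ to $y$; $\Gamma_i=\{x:\delta(x,s)=i\}$ and $d=\max_x\delta(x,s)$. $\widehat X$ is sink-distance-regular if the sink has out-degree $0$, every edge with tail in $\Gamma_i$ has head in $\Gamma_{i-1}\cup\Gamma_i\cup\Gamma_{i+1}$ ($\Gamma_{d+1}=\emptyset$), and there are nonnegative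 integers $a_1,\dots,a_d$ and positive integers $b_1,\dots,b_{d-1}$, $c_1,\dots,c_d$ (with $b_d:=0$) such that: each $v\in\Gamma_1$ is the tail of exactly $c_1$ edges with head the sink; each $v\in\Gamma_i$, $i>1$, is the tail of exactly $c_i$ edges with heads in $\Gamma_{i-1}$ and the head of exactly $c_i$ edges with tails in $\Gamma_{i-1}$; and each $v\in\Gamma_i$, $i\ge1$, is the tail of exactly $a_i$ edges with heads in $\Gamma_i$, the head of exactly $a_i$ edges with tails in $\Gamma_i$, the tail of exactly $b_i$ edges with heads in $\Gamma_{i+1}$, and the head of exactly $b_i$ edges with tails in $\Gamma_{i+1}$. $\deg^{+}(\Gamma_i)=a_i+b_i+c_i$ is the common out-degree of the vertices of $\Gamma_i$ ($i\ge1$). $\gamma_i$ is the configuration with one grain on each vertex of $\Gamma_i$ and none elsewhere. *)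

theory Defs
  imports Complex_Main "Graph_Theory.Graph_Theory" "HOL-Algebra.Group"
begin

section \<open>Sandpiles on directed multigraphs with a sink\<close>

definition sandpile_graph :: "('a, 'b) pre_digraph \<Rightarrow> 'a \<Rightarrow> bool" where
  "sandpile_graph X s \<longleftrightarrow>
     fin_digraph X \<and> Digraph_Component.connected X \<and>
     s \<in> verts X \<and> (\<forall>v \<in> verts X. v \<rightarrow>\<^sup>*\<^bsub>X\<^esub> s) \<and> verts X - {s} \<noteq> {}"

definition num_arcs :: "('a, 'b) pre_digraph \<Rightarrow> 'a set \<Rightarrow> 'a set \<Rightarrow> nat" where
  "num_arcs X A B = card {e \<in> arcs X. tail X e \<in> A \<and> head X e \<in> B}"

text \<open>Configurations are total functions that vanish off the non-sink vertices.\<close>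

definition configs :: "('a, 'b) pre_digraph \<Rightarrow> 'a \<Rightarrow> ('a \<Rightarrow> nat) set" where
  "configs X s = {f. \<forall>v. v \<notin> verts X - {s} \<longrightarrow> f v = 0}"

definition stable_configs :: "('a, 'b) pre_digraph \<Rightarrow> 'a \<Rightarrow> ('a \<Rightarrow> nat) set" where
  "stable_configs X s = {f \<in> configs X s. \<forall>v \<in> verts X - {s}. f v < out_degree X v}"

text \<open>The natural-number subtraction is exact whenever \<open>v\<close> is unstable, the only case in
  which \<open>topples\<close> uses it. A loop at \<open>v\<close> returns its grain to \<open>v\<close>.\<close>

definition topple :: "('a, 'b) pre_digraph \<Rightarrow> 'a \<Rightarrow> 'a \<Rightarrow> ('a \<Rightarrow> nat) \<Rightarrow> ('a \<Rightarrow> nat)" where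
  "topple X s v f =
     (\<lambda>u. if u \<in> verts X - {s}
          then f u - (if u = v then out_degree X v else 0) + num_arcs X {v} {u}
          else 0)"

definition topples :: "('a, 'b) pre_digraph \<Rightarrow> 'a \<Rightarrow> ('a \<Rightarrow> nat) \<Rightarrow> ('a \<Rightarrow> nat) \<Rightarrow> bool" where
  "topples X s f g \<longleftrightarrow> (\<exists>v \<in> verts X - {s}. out_degree X v \<le> f v \<and> g = topple X s v f)"

definition stabilization :: "('a, 'b) pre_digraph \<Rightarrow> 'a \<Rightarrow> ('a \<Rightarrow> nat) \<Rightarrow> ('a \<Rightarrow> nat)" where
  "stabilization X s f = (THE g. (topples X s)\<^sup>*\<^sup>* f g \<and> g \<in> stable_configs X s)"

definition sandpile_monoid :: "('a, 'b) pre_digraph \<Rightarrow> 'a \<Rightarrow> ('a \<Rightarrow> nat) monoid" where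
  "sandpile_monoid X s =
     \<lparr>carrier = stable_configs X s,
      mult = (\<lambda>f g. stabilization X s (\<lambda>v. f v + g v)),
      one = (\<lambda>v. 0)\<rparr>"

definition monoid_ideal :: "('m, 'k) monoid_scheme \<Rightarrow> 'm set \<Rightarrow> bool" where
  "monoid_ideal M I \<longleftrightarrow> I \<noteq> {} \<and> I \<subseteq> carrier M \<and>
     (\<forall>x \<in> I. \<forall>m \<in> carrier M. x \<otimes>\<^bsub>M\<^esub> m \<in> I \<and> m \<otimes>\<^bsub>M\<^esub> x \<in> I)"

definition minimal_ideal :: "('m, 'k) monoid_scheme \<Rightarrow> 'm set" where
  "minimal_ideal M =
     (THE I. monoid_ideal M I \<and> (\<forall>J. monoid_ideal M J \<longrightarrow> J \<subseteq> I \<longrightarrow> J = I))"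

text \<open>The identity of the sandpile group is in general not the identity (the zero
  configuration) of the sandpile monoid.\<close>

definition sandpile_group :: "('a, 'b) pre_digraph \<Rightarrow> 'a \<Rightarrow> ('a \<Rightarrow> nat) monoid" where
  "sandpile_group X s =
     (let M = sandpile_monoid X s; K = minimal_ideal M in
      \<lparr>carrier = K,
       mult = mult M,
       one = (THE e. e \<in> K \<and> (\<forall>x \<in> K. e \<otimes>\<^bsub>M\<^esub> x = x \<and> x \<otimes>\<^bsub>M\<^esub> e = x))\<rparr>)"

section \<open>Sink-distance-regular directed graphs\<close>

text \<open>The distance is meaningful only if some directed path from \<open>x\<close> to \<open>y\<close> exists; in a
  sandpile graph this holds for every \<open>x\<close> when \<open>y\<close> is the sink.\<close>

definition dipath_dist :: "('a, 'b) pre_digraph \<Rightarrow> 'a \<Rightarrow> 'a \<Rightarrow> nat" where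
  "dipath_dist X x y = (LEAST k. \<exists>p. pre_digraph.apath X x p y \<and> length p = k)"

definition level :: "('a, 'b) pre_digraph \<Rightarrow> 'a \<Rightarrow> nat \<Rightarrow> 'a set" where
  "level X s i = {x \<in> verts X. dipath_dist X x s = i}"

definition level_config :: "('a, 'b) pre_digraph \<Rightarrow> 'a \<Rightarrow> nat \<Rightarrow> ('a \<Rightarrow> nat)" where
  "level_config X s i = (\<lambda>v. if v \<in> level X s i then 1 else 0)"

text \<open>In the arc condition the index \<open>i - 1\<close> is truncated for \<open>i = 0\<close>, but no arc has its
  tail at the sink.\<close>

definition sink_distance_regular ::
  "('a, 'b) pre_digraph \<Rightarrow> 'a \<Rightarrow> nat \<Rightarrow> (nat \<Rightarrow> nat) \<Rightarrow> (nat \<Rightarrow> nat) \<Rightarrow> (nat \<Rightarrow> nat) \<Rightarrow> bool" where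
  "sink_distance_regular X s d a b c \<longleftrightarrow>
     sandpile_graph X s \<and>
     d = Max ((\<lambda>x. dipath_dist X x s) ` verts X) \<and>
     out_degree X s = 0 \<and>
     (\<forall>i. \<forall>e \<in> arcs X. tail X e \<in> level X s i \<longrightarrow>
        head X e \<in> level X s (i - 1) \<union> level X s i \<union> level X s (i + 1)) \<and>
     b d = 0 \<and>
     (\<forall>i. 1 \<le> i \<and> i < d \<longrightarrow> 0 < b i) \<and>
     (\<forall>i. 1 \<le> i \<and> i \<le> d \<longrightarrow> 0 < c i) \<and>
     (\<forall>v \<in> level X s 1. num_arcs X {v} {s} = c 1) \<and>
     (\<forall>i. 1 < i \<and> i \<le> d \<longrightarrow> (\<forall>v \<in> level X s i.
        num_arcs X {v} (level X s (i - 1)) = c i \<and>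
        num_arcs X (level X s (i - 1)) {v} = c i)) \<and>
     (\<forall>i. 1 \<le> i \<and> i \<le> d \<longrightarrow> (\<forall>v \<in> level X s i.
        num_arcs X {v} (level X s i) = a i \<and>
        num_arcs X (level X s i) {v} = a i \<and>
        num_arcs X {v} (level X s (i + 1)) = b i \<and>
        num_arcs X (level X s (i + 1)) {v} = b i))"

text \<open>The out-degree shared by all vertices of level \<open>i\<close>, for \<open>1 \<le> i \<le> d\<close>.\<close>

definition level_degree :: "(nat \<Rightarrow> nat) \<Rightarrow> (nat \<Rightarrow> nat) \<Rightarrow> (nat \<Rightarrow> nat) \<Rightarrow> nat \<Rightarrow> nat" where
  "level_degree a b c i = a i + b i + c i"

end

theory Submission
  imports Defs "HOL-Library.Confluence"
begin

text \<open>
  Write \<open>e\<^sub>i = n\<^sub>i c\<^sub>i - n\<^sub>i\<^sub>+\<^sub>1 b\<^sub>i\<close>. The floors are chosen so that \<open>a\<^sub>i + b\<^sub>i \<le> e\<^sub>i < a\<^sub>i + b\<^sub>i + c\<^sub>i\<close>, so \<open>e\<close> is stable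
  and \<open>c\<^sub>j\<close> extra grains on each vertex of level \<open>j\<close> cause an avalanche toppling the levels
  \<open>j, \<dots>, d\<close> once each, whose net effect is to move these grains out of level \<open>j\<close> and to add
  \<open>b\<^sub>j\<^sub>-\<^sub>1\<close> grains to each vertex of level \<open>j - 1\<close>. Running \<open>k\<^sub>d\<close> avalanches from level \<open>d\<close>, then
  \<open>k\<^sub>d\<^sub>-\<^sub>1\<close> from level \<open>d - 1\<close>, and so on, shows that \<open>e + \<Sum>\<^sub>i (k\<^sub>i c\<^sub>i - k\<^sub>i\<^sub>+\<^sub>1 b\<^sub>i) \<gamma>\<^sub>i\<close> stabilizes to \<open>e\<close>
  whenever all coefficients are nonnegative. For \<open>k = n\<close> this says that \<open>e\<close> is idempotent; for
  \<open>k\<^sub>i\<close> growing fast enough as \<open>i\<close> decreases the starting configuration exceeds every stable one,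
  so \<open>e\<close> is recurrent. The same \<open>k\<^sub>i\<close>, summed from the sink outwards, give a weight that is
  strictly superharmonic and hence proves that stabilization terminates.
\<close>

section \<open>Toppling and stabilization\<close>

lemma topple_commute:
  assumes "v \<noteq> w" "out_degree X v \<le> f v" "out_degree X w \<le> f w"
  shows "topple X s v (topple X s w f) = topple X s w (topple X s v f)"
  using assms by (auto simp: topple_def fun_eq_iff)

lemma le_topple:
  assumes "v \<noteq> w" "v \<in> verts X - {s}"
  shows "f v \<le> topple X s w f v"
  using assms by (auto simp: topple_def)

text \<open>Toppling one unstable vertex never takes grains from another, so two distinct unstable
  vertices can be toppled in either order with the same result.\<close>

lemma topples_confluent: "confluentp (topples X s)"
proof (rule strong_confluentp_imp_confluentp, rule strong_confluentpI)
  fix f g h assume "topples X s f g" "topples X s f h"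
  then obtain v w where v: "v \<in> verts X - {s}" "out_degree X v \<le> f v" "g = topple X s v f"
    and w: "w \<in> verts X - {s}" "out_degree X w \<le> f w" "h = topple X s w f"
    by (auto simp: topples_def)
  show "\<exists>u. (topples X s)\<^sup>*\<^sup>* g u \<and> (topples X s)\<^sup>=\<^sup>= h u"
  proof (cases "v = w")
    case True
    then show ?thesis using v w by auto
  next
    case False
    have "topples X s g (topple X s w g)"
      using w v False le_topple[of w v X s f] unfolding topples_def by (intro bexI[of _ w]) auto
    moreover have "topples X s h (topple X s v h)"
      using w v False le_topple[of v w X s f] unfolding topples_def by (intro bexI[of _ v]) auto
    moreover have "topple X s w g = topple X s v h"
      using topple_commute[OF False v(2) w(2)] v w by simp
    ultimately show ?thesis by auto
  qed
qed

lemma stable_no_topples: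
  assumes "g \<in> stable_configs X s" "(topples X s)\<^sup>*\<^sup>* g h"
  shows "h = g"
  using assms(2)
proof (cases rule: converse_rtranclpE)
  case (step y)
  then show ?thesis using assms(1) by (force simp: topples_def stable_configs_def)
qed auto

text \<open>By confluence at most one stable configuration is reachable, so a single legal toppling
  sequence to a stable configuration settles the definite description.\<close>

lemma stabilization_eq:
  assumes "(topples X s)\<^sup>*\<^sup>* f g" "g \<in> stable_configs X s"
  shows "stabilization X s f = g"
  unfolding stabilization_def
proof (rule the_equality)
  fix h assume "(topples X s)\<^sup>*\<^sup>* f h \<and> h \<in> stable_configs X s"
  then show "h = g"
    using confluentpD[OF topples_confluent assms(1), of h] assms(2) stable_no_topples by metis
qed (use assms in simp)

lemma topples_add:
  assumes "topples X s f g" "h \<in> configs X s"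
  shows "topples X s (\<lambda>v. f v + h v) (\<lambda>v. g v + h v)"
proof -
  obtain v where v: "v \<in> verts X - {s}" "out_degree X v \<le> f v" "g = topple X s v f"
    using assms(1) by (auto simp: topples_def)
  have "(\<lambda>u. g u + h u) = topple X s v (\<lambda>u. f u + h u)"
    using v assms(2) by (auto simp: topple_def configs_def fun_eq_iff)
  then show ?thesis
    using v unfolding topples_def by (metis trans_le_add1)
qed

lemma rtranclp_topples_add:
  assumes "(topples X s)\<^sup>*\<^sup>* f g" "h \<in> configs X s"
  shows "(topples X s)\<^sup>*\<^sup>* (\<lambda>v. f v + h v) (\<lambda>v. g v + h v)"
  using assms(1)
  by (induction rule: rtranclp_induct) (auto intro: rtranclp.rtrancl_into_rtrancl topples_add[OF _ assms(2)])

lemma topples_in_configs: "topples X s f g \<Longrightarrow> g \<in> configs X s"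
  by (auto simp: topples_def topple_def configs_def)

lemma add_in_configs:
  "f \<in> configs X s \<Longrightarrow> g \<in> configs X s \<Longrightarrow> (\<lambda>v. f v + g v) \<in> configs X s"
  by (auto simp: configs_def)

lemma stable_in_configs: "f \<in> stable_configs X s \<Longrightarrow> f \<in> configs X s"
  by (auto simp: stable_configs_def)

text \<open>A strictly superharmonic weight turns the total weight of the grains into a quantity
  that decreases with every toppling.\<close>

lemma (in fin_digraph) stable_reachable_if_superharmonic:
  fixes W :: "'a \<Rightarrow> nat"
  assumes W: "\<And>v. v \<in> verts G - {s} \<Longrightarrow> (\<Sum>e\<in>out_arcs G v. W (head G e)) < out_degree G v * W v"
    and "f \<in> configs G s"
  shows "\<exists>g \<in> stable_configs G s. (topples G s)\<^sup>*\<^sup>* f g"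
  using assms(2)
proof (induction "\<Sum>v\<in>verts G - {s}. f v * W v" arbitrary: f rule: less_induct)
  case less
  show ?case
  proof (cases "f \<in> stable_configs G s")
    case False
    then obtain v where v: "v \<in> verts G - {s}" "out_degree G v \<le> f v"
      using less.prems by (auto simp: stable_configs_def not_less)
    let ?V = "verts G - {s}" and ?g = "topple G s v f"
    have step: "topples G s f ?g" using v by (auto simp: topples_def)
    have "(\<Sum>u\<in>?V. num_arcs G {v} {u} * W u) = (\<Sum>u\<in>?V. \<Sum>e | e \<in> out_arcs G v \<and> head G e = u. W (head G e))"
      by (intro sum.cong) (auto simp: num_arcs_def out_arcs_def conj_ac intro!: arg_cong[where f = card])
    also have "\<dots> = (\<Sum>e | e \<in> out_arcs G v \<and> head G e \<in> ?V. W (head G e))"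
    proof -
      have "(\<Sum>u\<in>?V. \<Sum>e | e \<in> out_arcs G v \<and> head G e = u. W (head G e))
        = (\<Sum>u\<in>?V. \<Sum>e | e \<in> {e \<in> out_arcs G v. head G e \<in> ?V} \<and> head G e = u. W (head G e))"
        by (intro sum.cong) auto
      also have "\<dots> = (\<Sum>e | e \<in> out_arcs G v \<and> head G e \<in> ?V. W (head G e))"
        by (rule sum.group) auto
      finally show ?thesis .
    qed
    \<comment> \<open>The arcs into the sink, whose grains vanish, account for the
      inequality.\<close>
    also have "\<dots> \<le> (\<Sum>e\<in>out_arcs G v. W (head G e))"
      by (rule sum_mono2) auto
    also have "\<dots> < out_degree G v * W v" using W v by blast
    finally have lt: "(\<Sum>u\<in>?V. num_arcs G {v} {u} * W u) < out_degree G v * W v" .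
    \<comment> \<open>The weight lost at \<open>v\<close> is added on the left to cancel the
      truncated subtraction in \<open>topple\<close>.\<close>
    have "(\<Sum>u\<in>?V. ?g u * W u) + out_degree G v * W v
        = (\<Sum>u\<in>?V. ?g u * W u) + (\<Sum>u\<in>?V. if u = v then out_degree G v * W v else 0)"
      using v(1) by (subst sum.delta) auto
    also have "\<dots> = (\<Sum>u\<in>?V. f u * W u + num_arcs G {v} {u} * W u)"
      unfolding sum.distrib[symmetric]
    proof (intro sum.cong refl)
      fix u assume "u \<in> ?V"
      then show "?g u * W u + (if u = v then out_degree G v * W v else 0)
        = f u * W u + num_arcs G {v} {u} * W u"
        using v(2) by (auto simp: topple_def add_mult_distrib[symmetric])
    qed
    also have "\<dots> = (\<Sum>u\<in>?V. f u * W u) + (\<Sum>u\<in>?V. num_arcs G {v} {u} * W u)"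
      by (rule sum.distrib)
    finally have "(\<Sum>u\<in>?V. ?g u * W u) < (\<Sum>u\<in>?V. f u * W u)" using lt by linarith
    from less.hyps[OF this topples_in_configs[OF step]] step show ?thesis
      by (meson converse_rtranclp_into_rtranclp)
  qed auto
qed

text \<open>The vertices of \<open>S\<close> are toppled one by one; earlier topplings only add
  grains to the remaining ones, so instability at the start suffices.\<close>

lemma rtranclp_topple_set:
  assumes "finite S" "finite (arcs X)" "S \<subseteq> verts X - {s}" "f \<in> configs X s"
    and "\<And>v. v \<in> S \<Longrightarrow> out_degree X v \<le> f v"
  shows "(topples X s)\<^sup>*\<^sup>* f (\<lambda>u. if u \<in> verts X - {s}
           then f u - (if u \<in> S then out_degree X u else 0) + num_arcs X S {u} else 0)"
    (is "(topples X s)\<^sup>*\<^sup>* f (?t S)")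
  using assms(1,3,5)
proof (induction S rule: finite_induct)
  case empty
  have "?t {} = f" using assms(4) by (auto simp: num_arcs_def configs_def fun_eq_iff)
  then show ?case by simp
next
  case (insert v S)
  have arcs: "num_arcs X (insert v S) {u} = num_arcs X {v} {u} + num_arcs X S {u}" for u
  proof -
    have "{e \<in> arcs X. tail X e \<in> insert v S \<and> head X e \<in> {u}}
      = {e \<in> arcs X. tail X e \<in> {v} \<and> head X e \<in> {u}} \<union> {e \<in> arcs X. tail X e \<in> S \<and> head X e \<in> {u}}"
      by auto
    then show ?thesis
      unfolding num_arcs_def using insert.hyps assms(2) by (auto intro!: card_Un_disjoint)
  qed
  have v: "v \<in> verts X - {s}" "out_degree X v \<le> f v" using insert.prems by auto
  have "?t (insert v S) = topple X s v (?t S)"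
  proof
    fix u show "?t (insert v S) u = topple X s v (?t S) u"
      using v insert.hyps(2) by (auto simp: topple_def arcs)
  qed
  moreover have "out_degree X v \<le> ?t S v" using v insert.hyps(2) by auto
  ultimately have "topples X s (?t S) (?t (insert v S))"
    using v(1) unfolding topples_def by blast
  moreover have "(topples X s)\<^sup>*\<^sup>* f (?t S)" using insert by auto
  ultimately show ?case by (rule rtranclp.rtrancl_into_rtrancl[rotated])
qed

section \<open>The identity of the sandpile group\<close>

text \<open>Isolates the existence of stabilizations, so that the algebra does not depend on how
  termination is proved.\<close>

locale stabilizing =
  fixes X :: "('a, 'b) pre_digraph" and s :: 'a
  assumes stable_reachable: "f \<in> configs X s \<Longrightarrow> \<exists>g \<in> stable_configs X s. (topples X s)\<^sup>*\<^sup>* f g"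
begin

lemma stabilization_topples:
  assumes "f \<in> configs X s"
  shows "(topples X s)\<^sup>*\<^sup>* f (stabilization X s f)" "stabilization X s f \<in> stable_configs X s"
  using stable_reachable[OF assms] stabilization_eq by metis+

lemma stabilization_cong:
  assumes "(topples X s)\<^sup>*\<^sup>* f g" "f \<in> configs X s"
  shows "stabilization X s f = stabilization X s g"
proof -
  have "g \<in> configs X s"
    using assms by (induction rule: rtranclp_induct) (auto dest: topples_in_configs)
  then show ?thesis
    using assms(1) stabilization_topples[of g] by (metis stabilization_eq rtranclp_trans)
qed

text \<open>A legal sequence for \<open>f\<close> stays legal with \<open>g\<close> added.
  Associativity of the sandpile monoid rests on this.\<close>

lemma stabilization_add_stabilization:
  assumes "f \<in> configs X s" "g \<in> configs X s"
  shows "stabilization X s (\<lambda>v. stabilization X s f v + g v) = stabilization X s (\<lambda>v. f v + g v)"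
  using stabilization_cong[OF rtranclp_topples_add[OF stabilization_topples(1)[OF assms(1)] assms(2)]]
    add_in_configs[OF assms] by simp

lemma comm_monoid_sandpile:
  assumes pos: "\<And>v. v \<in> verts X - {s} \<Longrightarrow> 0 < out_degree X v"
  shows "comm_monoid (sandpile_monoid X s)"
proof (rule comm_monoidI)
  let ?M = "sandpile_monoid X s"
  show "x \<otimes>\<^bsub>?M\<^esub> y \<in> carrier ?M" if "x \<in> carrier ?M" "y \<in> carrier ?M" for x y
    using that by (auto simp: sandpile_monoid_def stable_in_configs add_in_configs
        intro!: stabilization_topples(2))
  show "\<one>\<^bsub>?M\<^esub> \<in> carrier ?M"
    using pos by (auto simp: sandpile_monoid_def stable_configs_def configs_def)
  show "x \<otimes>\<^bsub>?M\<^esub> y = y \<otimes>\<^bsub>?M\<^esub> x" for x y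
    by (simp add: sandpile_monoid_def add.commute)
  show "\<one>\<^bsub>?M\<^esub> \<otimes>\<^bsub>?M\<^esub> x = x" if "x \<in> carrier ?M" for x
    using that by (auto simp: sandpile_monoid_def intro: stabilization_eq)
  show "x \<otimes>\<^bsub>?M\<^esub> y \<otimes>\<^bsub>?M\<^esub> z = x \<otimes>\<^bsub>?M\<^esub> (y \<otimes>\<^bsub>?M\<^esub> z)"
    if "x \<in> carrier ?M" "y \<in> carrier ?M" "z \<in> carrier ?M" for x y z
  proof -
    have c: "x \<in> configs X s" "y \<in> configs X s" "z \<in> configs X s"
      using that by (auto simp: sandpile_monoid_def stable_in_configs)
    have "x \<otimes>\<^bsub>?M\<^esub> (y \<otimes>\<^bsub>?M\<^esub> z) = stabilization X s (\<lambda>v. stabilization X s (\<lambda>v. y v + z v) v + x v)"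
      by (simp add: sandpile_monoid_def add.commute)
    also have "\<dots> = stabilization X s (\<lambda>v. y v + z v + x v)"
      by (intro stabilization_add_stabilization add_in_configs c)
    also have "\<dots> = stabilization X s (\<lambda>v. x v + y v + z v)" by (simp add: add_ac)
    also have "\<dots> = x \<otimes>\<^bsub>?M\<^esub> y \<otimes>\<^bsub>?M\<^esub> z"
      using stabilization_add_stabilization[OF add_in_configs[OF c(1,2)] c(3)]
      by (simp add: sandpile_monoid_def)
    finally show ?thesis by simp
  qed
qed

end

text \<open>An element divisible by every other one lies in every ideal, so its multiples form the
  least ideal.\<close>

lemma (in comm_monoid) minimal_ideal_eq:
  assumes e: "e \<in> carrier G"
    and div: "\<And>x. x \<in> carrier G \<Longrightarrow> \<exists>y \<in> carrier G. x \<otimes> y = e"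
  shows "minimal_ideal G = (\<lambda>x. e \<otimes> x) ` carrier G"
proof -
  let ?K = "(\<lambda>x. e \<otimes> x) ` carrier G"
  have K: "monoid_ideal G ?K"
    unfolding monoid_ideal_def
  proof (intro conjI ballI)
    fix x m assume x: "x \<in> ?K" and m: "m \<in> carrier G"
    then obtain y where y: "y \<in> carrier G" "x = e \<otimes> y" by auto
    then have "x \<otimes> m = e \<otimes> (y \<otimes> m)" "m \<otimes> x = e \<otimes> (y \<otimes> m)"
      using e m by (simp_all add: m_ac)
    then show "x \<otimes> m \<in> ?K" "m \<otimes> x \<in> ?K" using y m by auto
  qed (use e in auto)
  have least: "?K \<subseteq> J" if J: "monoid_ideal G J" for J
  proof -
    obtain x where x: "x \<in> J" "x \<in> carrier G" using J by (auto simp: monoid_ideal_def)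
    then have "e \<in> J" using div[of x] J unfolding monoid_ideal_def by metis
    then show ?thesis using J by (auto simp: monoid_ideal_def)
  qed
  show ?thesis
    unfolding minimal_ideal_def
    by (rule the_equality) (use K least in blast)+
qed

text \<open>By \<open>rec\<close>, \<open>e\<close> is a multiple of every element, which identifies
  the minimal ideal and yields inverses; by \<open>idem\<close>, \<open>e\<close> acts as identity
  on its own multiples.\<close>

lemma (in stabilizing) sandpile_group_one:
  assumes pos: "\<And>v. v \<in> verts X - {s} \<Longrightarrow> 0 < out_degree X v"
    and e: "e \<in> stable_configs X s"
    and idem: "(topples X s)\<^sup>*\<^sup>* (\<lambda>v. e v + e v) e"
    and rec: "\<And>x. x \<in> stable_configs X s \<Longrightarrow> \<exists>h \<in> configs X s. (topples X s)\<^sup>*\<^sup>* (\<lambda>v. x v + h v) e"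
  shows "group (sandpile_group X s)" "\<one>\<^bsub>sandpile_group X s\<^esub> = e"
proof -
  define M where "M = sandpile_monoid X s"
  interpret M: comm_monoid M unfolding M_def by (rule comm_monoid_sandpile[OF pos])
  have carM: "carrier M = stable_configs X s" by (simp add: M_def sandpile_monoid_def)
  have eM: "e \<in> carrier M" using e carM by simp
  have ee: "e \<otimes>\<^bsub>M\<^esub> e = e" using stabilization_eq[OF idem e] by (simp add: M_def sandpile_monoid_def)
  \<comment> \<open>The summand \<open>h\<close> may be unstable; its stabilization is the required
    monoid element.\<close>
  have div: "\<exists>y \<in> carrier M. x \<otimes>\<^bsub>M\<^esub> y = e" if x: "x \<in> carrier M" for x
  proof -
    obtain h where h: "h \<in> configs X s" "(topples X s)\<^sup>*\<^sup>* (\<lambda>v. x v + h v) e"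
      using rec x carM by auto
    have xc: "x \<in> configs X s" using x carM stable_in_configs by simp
    have "x \<otimes>\<^bsub>M\<^esub> stabilization X s h = stabilization X s (\<lambda>v. stabilization X s h v + x v)"
      by (simp add: M_def sandpile_monoid_def add.commute)
    also have "\<dots> = stabilization X s (\<lambda>v. h v + x v)"
      by (rule stabilization_add_stabilization[OF h(1) xc])
    also have "\<dots> = e" using stabilization_eq[OF h(2) e] by (simp add: add.commute)
    finally show ?thesis using stabilization_topples(2)[OF h(1)] carM by blast
  qed
  let ?K = "(\<lambda>x. e \<otimes>\<^bsub>M\<^esub> x) ` carrier M"
  have min: "minimal_ideal M = ?K" by (rule M.minimal_ideal_eq[OF eM div])
  have eK: "e \<in> ?K" using eM ee by force
  have KM: "x \<in> carrier M" if "x \<in> ?K" for x using that eM by auto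
  have unit: "e \<otimes>\<^bsub>M\<^esub> x = x" "x \<otimes>\<^bsub>M\<^esub> e = x" if x: "x \<in> ?K" for x
  proof -
    obtain y where y: "y \<in> carrier M" "x = e \<otimes>\<^bsub>M\<^esub> y" using x by auto
    then show "e \<otimes>\<^bsub>M\<^esub> x = x" using M.m_assoc[OF eM eM y(1)] ee by simp
    then show "x \<otimes>\<^bsub>M\<^esub> e = x" using M.m_comm[OF KM[OF x] eM] by simp
  qed
  have group_def: "sandpile_group X s = \<lparr>carrier = ?K, mult = mult M,
     one = (THE e'. e' \<in> ?K \<and> (\<forall>x \<in> ?K. e' \<otimes>\<^bsub>M\<^esub> x = x \<and> x \<otimes>\<^bsub>M\<^esub> e' = x))\<rparr>"
    by (simp only: sandpile_group_def Let_def M_def[symmetric] min)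
  have one: "(THE e'. e' \<in> ?K \<and> (\<forall>x \<in> ?K. e' \<otimes>\<^bsub>M\<^esub> x = x \<and> x \<otimes>\<^bsub>M\<^esub> e' = x)) = e"
    by (rule the_equality) (use eK unit in metis)+
  have G: "sandpile_group X s = \<lparr>carrier = ?K, mult = mult M, one = e\<rparr>"
    by (simp only: group_def one)
  then show "\<one>\<^bsub>sandpile_group X s\<^esub> = e" by simp
  show "group (sandpile_group X s)"
    unfolding G
  proof (rule groupI; simp only: partial_object.simps monoid.simps)
    fix x y assume x: "x \<in> ?K" and y: "y \<in> ?K"
    then obtain z where "z \<in> carrier M" "x = e \<otimes>\<^bsub>M\<^esub> z" by auto
    then show "x \<otimes>\<^bsub>M\<^esub> y \<in> ?K" using KM[OF y] eM by (auto simp: M.m_assoc)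
  next
    fix x y z assume "x \<in> ?K" "y \<in> ?K" "z \<in> ?K"
    then show "x \<otimes>\<^bsub>M\<^esub> y \<otimes>\<^bsub>M\<^esub> z = x \<otimes>\<^bsub>M\<^esub> (y \<otimes>\<^bsub>M\<^esub> z)" by (intro M.m_assoc KM)
  next
    fix x assume x: "x \<in> ?K"
    obtain y where y: "y \<in> carrier M" "x \<otimes>\<^bsub>M\<^esub> y = e" using div[OF KM[OF x]] by auto
    \<comment> \<open>Multiplying by \<open>e\<close> moves the cofactor \<open>y\<close> into the
      minimal ideal.\<close>
    have "e \<otimes>\<^bsub>M\<^esub> y \<otimes>\<^bsub>M\<^esub> x = e"
      using y KM[OF x] eM ee by (simp add: M.m_assoc M.m_comm[of y x])
    then show "\<exists>y\<in>?K. y \<otimes>\<^bsub>M\<^esub> x = e" using y(1) by blast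
  qed (fact eK unit(1))+
qed

section \<open>Level-constant configurations\<close>

locale distance_regular =
  fixes X :: "('a, 'b) pre_digraph" and s :: 'a and d :: nat and a b c :: "nat \<Rightarrow> nat"
  assumes regular: "sink_distance_regular X s d a b c"
begin

section \<open>Distances to the sink and arc counts between levels\<close>

abbreviation dist_sink :: "'a \<Rightarrow> nat" where
  "dist_sink v \<equiv> dipath_dist X v s"

sublocale fin_digraph X
  using regular by (simp add: sink_distance_regular_def sandpile_graph_def)

lemma s_in_verts: "s \<in> verts X"
  using regular by (simp add: sink_distance_regular_def sandpile_graph_def)

text \<open>Reachability of the sink guarantees that the \<open>LEAST\<close> in the distance is
  attained by a path.\<close>

lemma dist_sink_eq_0_iff:
  assumes "v \<in> verts X"
  shows "dist_sink v = 0 \<longleftrightarrow> v = s"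
proof
  assume "dist_sink v = 0"
  have "v \<rightarrow>\<^sup>*\<^bsub>X\<^esub> s"
    using regular assms by (simp add: sink_distance_regular_def sandpile_graph_def)
  then obtain p where "apath v p s" using reachable_apath by auto
  then have "\<exists>k q. apath v q s \<and> length q = k" by blast
  from LeastI_ex[OF this] have "\<exists>q. apath v q s \<and> length q = dist_sink v"
    unfolding dipath_dist_def .
  then show "v = s" using \<open>dist_sink v = 0\<close> by (auto simp: apath_Nil_iff)
next
  assume "v = s"
  have "\<exists>p. apath s p s \<and> length p = 0" using s_in_verts by (simp add: apath_Nil_iff)
  then show "dist_sink v = 0" unfolding \<open>v = s\<close> dipath_dist_def by (simp add: Least_eq_0)
qed

lemma dist_sink_bounds:
  assumes "v \<in> verts X - {s}"
  shows "1 \<le> dist_sink v" "dist_sink v \<le> d"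
  using assms dist_sink_eq_0_iff[of v] regular by (auto simp: sink_distance_regular_def Suc_le_eq)

lemma in_level_iff: "v \<in> level X s i \<longleftrightarrow> v \<in> verts X \<and> dist_sink v = i"
  by (auto simp: level_def)

lemma level_0: "level X s 0 = {s}"
  using dist_sink_eq_0_iff s_in_verts by (auto simp: in_level_iff)

lemma b_d: "b d = 0"
  using regular unfolding sink_distance_regular_def by blast

lemma c_pos: "1 \<le> i \<Longrightarrow> i \<le> d \<Longrightarrow> 0 < c i"
  using regular by (simp add: sink_distance_regular_def)

lemma dist_head_cases:
  assumes "e \<in> arcs X"
  shows "dist_sink (head X e) \<in> {dist_sink (tail X e) - 1, dist_sink (tail X e), dist_sink (tail X e) + 1}"
proof -
  have "tail X e \<in> level X s (dist_sink (tail X e))" using assms by (simp add: in_level_iff)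
  then have "head X e \<in> level X s (dist_sink (tail X e) - 1) \<union> level X s (dist_sink (tail X e))
      \<union> level X s (dist_sink (tail X e) + 1)"
    using regular assms unfolding sink_distance_regular_def by blast
  then show ?thesis by (auto simp: in_level_iff)
qed

text \<open>Level 0 is \<open>{s}\<close>, so the separate condition on level 1 merges with that on
  the higher levels.\<close>

lemma num_arcs_from:
  assumes "v \<in> verts X - {s}"
  shows "num_arcs X {v} (level X s (dist_sink v - 1)) = c (dist_sink v)"
    "num_arcs X {v} (level X s (dist_sink v)) = a (dist_sink v)"
    "num_arcs X {v} (level X s (dist_sink v + 1)) = b (dist_sink v)"
proof -
  have v: "v \<in> level X s (dist_sink v)" using assms by (simp add: in_level_iff)
  note bounds = dist_sink_bounds[OF assms]
  show "num_arcs X {v} (level X s (dist_sink v - 1)) = c (dist_sink v)"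
  proof (cases "dist_sink v = 1")
    case True
    then show ?thesis using v regular by (simp add: sink_distance_regular_def level_0)
  next
    case False
    then have "1 < dist_sink v \<and> dist_sink v \<le> d" using bounds by simp
    then show ?thesis using v regular unfolding sink_distance_regular_def by blast
  qed
  show "num_arcs X {v} (level X s (dist_sink v)) = a (dist_sink v)"
    "num_arcs X {v} (level X s (dist_sink v + 1)) = b (dist_sink v)"
    using v bounds regular unfolding sink_distance_regular_def by blast+
qed

text \<open>These counts are the grains that \<open>u\<close> receives when all of level
  \<open>i\<close> topples once.\<close>

lemma num_arcs_into:
  assumes u: "u \<in> verts X - {s}" and i: "1 \<le> i"
  shows "num_arcs X (level X s i) {u} =
    (if i = dist_sink u then a i else if i + 1 = dist_sink u then c (i + 1)
     else if i = dist_sink u + 1 then b (dist_sink u) else 0)"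
proof -
  have v: "u \<in> level X s (dist_sink u)" using u by (simp add: in_level_iff)
  note bounds = dist_sink_bounds[OF u]
  have arcs: "num_arcs X (level X s (dist_sink u)) {u} = a (dist_sink u)"
    "num_arcs X (level X s (dist_sink u + 1)) {u} = b (dist_sink u)"
    using v bounds regular unfolding sink_distance_regular_def by blast+
  have arcs_lower: "num_arcs X (level X s i) {u} = c (i + 1)" if "i + 1 = dist_sink u"
  proof -
    have "1 < dist_sink u \<and> dist_sink u \<le> d" using bounds that i by simp
    then have "num_arcs X (level X s (dist_sink u - 1)) {u} = c (dist_sink u)"
      using v regular unfolding sink_distance_regular_def by blast
    moreover have "dist_sink u - 1 = i" using that by simp
    ultimately show ?thesis using that by simp
  qed
  have arcs_far: "num_arcs X (level X s i) {u} = 0"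
    if "i \<noteq> dist_sink u" "i + 1 \<noteq> dist_sink u" "i \<noteq> dist_sink u + 1"
  proof -
    have "{e \<in> arcs X. tail X e \<in> level X s i \<and> head X e \<in> {u}} = {}"
      using dist_head_cases that i by (fastforce simp: in_level_iff)
    then show ?thesis by (simp add: num_arcs_def)
  qed
  consider "i = dist_sink u" | "i + 1 = dist_sink u" | "i = dist_sink u + 1"
    | "i \<noteq> dist_sink u" "i + 1 \<noteq> dist_sink u" "i \<noteq> dist_sink u + 1" by blast
  then show ?thesis
  proof cases
    case 1 then show ?thesis using arcs(1) by simp
  next
    case 2 then show ?thesis using arcs_lower by simp
  next
    case 3 then show ?thesis using arcs(2) by simp
  next
    case 4 then show ?thesis using arcs_far by simp
  qed
qed

text \<open>The out-arcs are split by the level of their head. Constant \<open>w\<close> gives the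
  out-degree, a growing \<open>w\<close> the termination weight.\<close>

lemma sum_out_arcs_level:
  fixes w :: "nat \<Rightarrow> nat"
  assumes v: "v \<in> verts X - {s}"
  shows "(\<Sum>e\<in>out_arcs X v. w (dist_sink (head X e))) =
    c (dist_sink v) * w (dist_sink v - 1) + a (dist_sink v) * w (dist_sink v)
    + b (dist_sink v) * w (dist_sink v + 1)"
proof -
  let ?i = "dist_sink v"
  define A where "A j = {e \<in> arcs X. tail X e \<in> {v} \<and> head X e \<in> level X s j}" for j
  have i: "1 \<le> ?i" using dist_sink_bounds[OF v] by simp
  have split: "out_arcs X v = A (?i - 1) \<union> (A ?i \<union> A (?i + 1))"
    using dist_head_cases by (fastforce simp: A_def out_arcs_def in_level_iff)
  have fin: "finite (A j)" for j by (simp add: A_def)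
  have S: "(\<Sum>e\<in>A j. w (dist_sink (head X e))) = num_arcs X {v} (level X s j) * w j" for j
    by (simp add: A_def num_arcs_def in_level_iff)
  have disj: "A j \<inter> A k = {}" if "j \<noteq> k" for j k using that by (auto simp: A_def in_level_iff)
  have "A (?i - 1) \<inter> (A ?i \<union> A (?i + 1)) = {}"
    unfolding Int_Un_distrib using i by (simp add: disj)
  moreover have "A ?i \<inter> A (?i + 1) = {}" by (simp add: disj)
  ultimately have "(\<Sum>e\<in>out_arcs X v. w (dist_sink (head X e)))
    = (\<Sum>e\<in>A (?i - 1). w (dist_sink (head X e))) + ((\<Sum>e\<in>A ?i. w (dist_sink (head X e)))
      + (\<Sum>e\<in>A (?i + 1). w (dist_sink (head X e))))"
    unfolding split by (subst sum.union_disjoint) (simp_all add: sum.union_disjoint fin)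
  then show ?thesis unfolding S num_arcs_from[OF v] by simp
qed

lemma out_degree_level:
  assumes "v \<in> verts X - {s}"
  shows "out_degree X v = level_degree a b c (dist_sink v)"
proof -
  have "out_degree X v = (\<Sum>e\<in>out_arcs X v. 1)" by (simp add: out_degree_def)
  also have "\<dots> = level_degree a b c (dist_sink v)"
    unfolding sum_out_arcs_level[OF assms, of "\<lambda>_. 1"] level_degree_def by simp
  finally show ?thesis .
qed

section \<open>Toppling whole levels\<close>

definition spread :: "(nat \<Rightarrow> nat) \<Rightarrow> 'a \<Rightarrow> nat" where
  "spread p v = (if v \<in> verts X - {s} then p (dist_sink v) else 0)"

lemma spread_in_configs: "spread p \<in> configs X s"
  by (auto simp: spread_def configs_def)

text \<open>Profile values outside \<open>1, ..., d\<close> are invisible, which absorbs the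
  boundary cases at levels \<open>0\<close> and \<open>d + 1\<close>.\<close>

lemma spread_cong: "(\<And>i. 1 \<le> i \<Longrightarrow> i \<le> d \<Longrightarrow> p i = q i) \<Longrightarrow> spread p = spread q"
  using dist_sink_bounds by (auto simp: spread_def)

text \<open>The \<open>a i\<close> grains sent within the level are received back, so its net loss
  is \<open>b i + c i\<close> per vertex.\<close>

lemma topple_level:
  assumes i: "1 \<le> i" and p: "level_degree a b c i \<le> p i"
    and q: "\<And>j. q j = p j - (if j = i then b i + c i else 0)
              + (if j = i + 1 then c j else 0) + (if j + 1 = i then b j else 0)"
  shows "(topples X s)\<^sup>*\<^sup>* (spread p) (spread q)"
proof -
  let ?S = "level X s i"
  have S: "?S \<subseteq> verts X - {s}"
    using i dist_sink_eq_0_iff[OF s_in_verts] by (auto simp: in_level_iff)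
  let ?g = "\<lambda>u. if u \<in> verts X - {s}
     then spread p u - (if u \<in> ?S then out_degree X u else 0) + num_arcs X ?S {u} else 0"
  have "spread q = ?g"
  proof
    fix u
    show "spread q u = ?g u"
    proof (cases "u \<in> verts X - {s}")
      case True
      have "u \<in> ?S \<longleftrightarrow> dist_sink u = i" using True by (simp add: in_level_iff)
      then show ?thesis
        using True num_arcs_into[OF True i] out_degree_level[OF True] p
        by (auto simp: spread_def level_degree_def q)
    qed (auto simp: spread_def)
  qed
  moreover have "(topples X s)\<^sup>*\<^sup>* (spread p) ?g"
  proof (rule rtranclp_topple_set)
    fix v assume "v \<in> ?S"
    then show "out_degree X v \<le> spread p v"
      using S p out_degree_level[of v] by (auto simp: spread_def in_level_iff)
  qed (use S finite_subset[OF S] spread_in_configs in auto)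
  ultimately show ?thesis by simp
qed

text \<open>If every vertex at level \<open>i \<ge> j\<close> lacks at most \<open>c i\<close> grains to be unstable, then \<open>c j\<close>
  extra grains on level \<open>j\<close> start an avalanche that topples the levels \<open>j, \<dots>, d\<close> once each
  and restores all of them.\<close>

lemma topple_levels_from:
  assumes "1 \<le> j" "j \<le> d + 1"
    and "\<And>i. j \<le> i \<Longrightarrow> i \<le> d \<Longrightarrow> a i + b i \<le> p i"
    and "\<And>i. f i = p i + (if i = j then c i else 0)"
    and "\<And>i. g i = p i + (if i + 1 = j then b i else 0)"
  shows "(topples X s)\<^sup>*\<^sup>* (spread f) (spread g)"
  using assms(2-)
proof (induction arbitrary: p f g rule: inc_induct)
  case base
  \<comment> \<open>The avalanche from level \<open>d + 1\<close> is empty: the extra grains lie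
    outside the graph and \<open>b d = 0\<close>.\<close>
  have "spread f = spread g" using b_d by (intro spread_cong) (auto simp: base)
  then show ?case by simp
next
  case (step m)
  have m: "1 \<le> m" "m \<le> d" using step.hyps assms(1) by auto
  have pm: "a m + b m \<le> p m" using step.prems(1) m by simp
  \<comment> \<open>Toppling level \<open>m\<close> leaves it \<open>b m\<close> grains short and
    puts \<open>c (Suc m)\<close> extra grains on the next level; the avalanche they start returns
    exactly the missing \<open>b m\<close>.\<close>
  define p' where "p' i = p i - (if i = m then b m else 0) + (if i + 1 = m then b i else 0)" for i
  define r where "r i = p' i + (if i = Suc m then c i else 0)" for i
  have "(topples X s)\<^sup>*\<^sup>* (spread f) (spread r)"
    by (rule topple_level[OF m(1)])
      (use pm in \<open>auto simp: level_degree_def step.prems(2) r_def p'_def\<close>)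
  moreover have "(topples X s)\<^sup>*\<^sup>* (spread r) (spread g)"
    by (rule step.IH[of p'])
      (use step.prems(1) pm in \<open>auto simp: r_def p'_def step.prems(3)\<close>)
  ultimately show ?case by (rule rtranclp_trans)
qed

text \<open>Each avalanche restores the levels from \<open>j\<close> on, so it can be repeated; its
  deposit on level \<open>j - 1\<close> is absorbed into the base profile.\<close>

lemma topple_levels_from_times:
  assumes "1 \<le> j" "j \<le> d + 1"
    and "\<And>i. j \<le> i \<Longrightarrow> i \<le> d \<Longrightarrow> a i + b i \<le> p i"
    and "\<And>i. f i = p i + (if i = j then k * c i else 0)"
    and "\<And>i. g i = p i + (if i + 1 = j then k * b i else 0)"
  shows "(topples X s)\<^sup>*\<^sup>* (spread f) (spread g)"
  using assms(3-)
proof (induction k arbitrary: p f g)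
  case 0
  then have "f = g" by auto
  then show ?case by simp
next
  case (Suc k)
  define p' where "p' i = p i + (if i + 1 = j then b i else 0)" for i
  define r where "r i = p' i + (if i = j then k * c i else 0)" for i
  have "(topples X s)\<^sup>*\<^sup>* (spread f) (spread r)"
    by (rule topple_levels_from[OF assms(1,2), of "\<lambda>i. p i + (if i = j then k * c i else 0)"])
      (use Suc.prems(1) in \<open>auto simp: Suc.prems(2) r_def p'_def intro: trans_le_add1\<close>)
  moreover have "(topples X s)\<^sup>*\<^sup>* (spread r) (spread g)"
    by (rule Suc.IH[of p'])
      (use Suc.prems(1) in \<open>auto simp: Suc.prems(3) r_def p'_def intro: trans_le_add1\<close>)
  ultimately show ?case by (rule rtranclp_trans)
qed

text \<open>The avalanches from level \<open>d\<close> are run first, then those from level \<open>d - 1\<close>, and so on: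
  each phase returns to the next lower level the grains missing there.\<close>

lemma topple_level_firing:
  assumes p: "\<And>i. 1 \<le> i \<Longrightarrow> i \<le> d \<Longrightarrow> a i + b i \<le> p i"
    and k: "\<And>i. 1 \<le> i \<Longrightarrow> i \<le> d \<Longrightarrow> k (i + 1) * b i \<le> k i * c i"
  shows "(topples X s)\<^sup>*\<^sup>* (spread (\<lambda>i. p i + (k i * c i - k (i + 1) * b i))) (spread p)"
proof -
  define D where "D i = k i * c i - k (i + 1) * b i" for i
  \<comment> \<open>The profile once the levels from \<open>j\<close> on are finished: the arrivals
    at level \<open>j - 1\<close> have cancelled the subtraction in \<open>D\<close>, and lower
    levels are untouched.\<close>
  define P where "P j i = p i + (if j \<le> i then 0 else if i + 1 = j then k i * c i else D i)" for j i
  have "(topples X s)\<^sup>*\<^sup>* (spread (\<lambda>i. p i + D i)) (spread (P j))" if "1 \<le> j" "j \<le> d + 1" for j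
    using that(2,1)
  proof (induction rule: inc_induct)
    case base
    have "spread (\<lambda>i. p i + D i) = spread (P (d + 1))"
      using b_d by (intro spread_cong) (auto simp: P_def D_def)
    then show ?case by simp
  next
    case (step m)
    have m: "1 \<le> m" "m \<le> d" using step.hyps step.prems by auto
    define q where "q i = p i + (if m \<le> i then 0 else D i)" for i
    define r where "r i = q i + (if i + 1 = m then k m * b i else 0)" for i
    have last: "spread (P m) = spread r"
      using k m by (intro spread_cong) (auto simp: P_def q_def r_def D_def)
    have "(topples X s)\<^sup>*\<^sup>* (spread (\<lambda>i. p i + D i)) (spread (P (Suc m)))"
      using step by simp
    moreover have "(topples X s)\<^sup>*\<^sup>* (spread (P (Suc m))) (spread (P m))"
      unfolding last
      by (rule topple_levels_from_times[of m q _ "k m"]) (use m p in \<open>auto simp: P_def q_def r_def\<close>)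
    ultimately show ?case by (rule rtranclp_trans)
  qed
  from this[of 1] have "(topples X s)\<^sup>*\<^sup>* (spread (\<lambda>i. p i + D i)) (spread (P 1))" by simp
  moreover have "spread (P 1) = spread p" by (intro spread_cong) (auto simp: P_def)
  ultimately show ?thesis by (simp add: D_def)
qed

section \<open>Firing numbers, termination and the identity element\<close>

lemma ex_large_firing:
  "\<exists>k :: nat \<Rightarrow> nat. \<forall>i. 1 \<le> i \<longrightarrow> i \<le> d \<longrightarrow> k (i + 1) * b i + level_degree a b c i \<le> k i * c i"
proof -
  \<comment> \<open>The recursion runs inwards from \<open>k (d + 1) = 0\<close>, adding one full
    degree per level; \<open>c i \<ge> 1\<close> then gives the inequality.\<close>
  define r where "r = rec_nat 0 (\<lambda>j x. x * b (d - j) + level_degree a b c (d - j))"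
  define k where "k i = r (d + 1 - i)" for i
  have "k (i + 1) * b i + level_degree a b c i \<le> k i * c i" if i: "1 \<le> i" "i \<le> d" for i
  proof -
    have "d + 1 - i = Suc (d - i)" using i by simp
    then have "k i = k (i + 1) * b i + level_degree a b c i" using i by (simp add: k_def r_def)
    then show ?thesis using c_pos[OF i] by (metis One_nat_def Suc_leI mult.right_neutral mult_le_mono2)
  qed
  then show ?thesis by blast
qed

lemma level_degree_pos: "1 \<le> i \<Longrightarrow> i \<le> d \<Longrightarrow> 0 < level_degree a b c i"
  using c_pos[of i] by (simp add: level_degree_def)

sublocale stabilizing X s
proof
  fix f assume f: "f \<in> configs X s"
  obtain k :: "nat \<Rightarrow> nat"
    where k: "\<And>i. 1 \<le> i \<Longrightarrow> i \<le> d \<Longrightarrow> k (i + 1) * b i + level_degree a b c i \<le> k i * c i"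
    using ex_large_firing by blast
  \<comment> \<open>An arc from level \<open>i\<close> loses weight \<open>k i\<close> inwards and
    gains \<open>k (i + 1)\<close> outwards, so strict superharmonicity amounts to
    \<open>k (i + 1) * b i < k i * c i\<close>.\<close>
  define w where "w i = (\<Sum>j=1..i. k j)" for i
  show "\<exists>g\<in>stable_configs X s. (topples X s)\<^sup>*\<^sup>* f g"
  proof (rule stable_reachable_if_superharmonic[OF _ f])
    fix v assume v: "v \<in> verts X - {s}"
    let ?i = "dist_sink v"
    have i: "1 \<le> ?i" "?i \<le> d" using dist_sink_bounds[OF v] by auto
    obtain j where j: "?i = Suc j" using i by (cases ?i) auto
    have "k (?i + 1) * b ?i < k ?i * c ?i"
      using k[OF i] level_degree_pos[OF i] by linarith
    moreover have "w ?i = w (?i - 1) + k ?i" "w (?i + 1) = w ?i + k (?i + 1)"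
      unfolding w_def j by simp_all
    ultimately show "(\<Sum>e\<in>out_arcs X v. w (dist_sink (head X e))) < out_degree X v * w ?i"
      unfolding sum_out_arcs_level[OF v] out_degree_level[OF v] level_degree_def
      by (simp add: algebra_simps)
  qed
qed

text \<open>The lower bound on \<open>p\<close> keeps avalanches running and the upper bound makes
  \<open>spread p\<close> stable. Firing by \<open>m\<close> proves idempotence, firing by a large
  \<open>k\<close> recurrence.\<close>

lemma sandpile_group_one_spread:
  assumes p: "\<And>i. 1 \<le> i \<Longrightarrow> i \<le> d \<Longrightarrow> a i + b i \<le> p i"
    and p_less: "\<And>i. 1 \<le> i \<Longrightarrow> i \<le> d \<Longrightarrow> p i < level_degree a b c i"
    and m: "\<And>i. 1 \<le> i \<Longrightarrow> i \<le> d \<Longrightarrow> m i * c i = p i + m (i + 1) * b i"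
  shows "group (sandpile_group X s)" "\<one>\<^bsub>sandpile_group X s\<^esub> = spread p"
proof -
  have pos: "0 < out_degree X v" if "v \<in> verts X - {s}" for v
    using out_degree_level[OF that] level_degree_pos dist_sink_bounds[OF that] by simp
  have stable: "spread p \<in> stable_configs X s"
    using spread_in_configs out_degree_level dist_sink_bounds p_less
    by (auto simp: stable_configs_def spread_def)
  \<comment> \<open>The relation for \<open>m\<close> makes the surplus equal to \<open>p\<close>
    itself.\<close>
  have "spread (\<lambda>i. p i + (m i * c i - m (i + 1) * b i)) = (\<lambda>v. spread p v + spread p v)"
    using m dist_sink_bounds by (auto simp: spread_def fun_eq_iff)
  then have idem: "(topples X s)\<^sup>*\<^sup>* (\<lambda>v. spread p v + spread p v) (spread p)"
    using topple_level_firing[of p m] p m by simp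
  obtain k :: "nat \<Rightarrow> nat"
    where k: "\<And>i. 1 \<le> i \<Longrightarrow> i \<le> d \<Longrightarrow> k (i + 1) * b i + level_degree a b c i \<le> k i * c i"
    using ex_large_firing by blast
  let ?g = "spread (\<lambda>i. p i + (k i * c i - k (i + 1) * b i))"
  have g: "(topples X s)\<^sup>*\<^sup>* ?g (spread p)"
    by (rule topple_level_firing[OF p]) (use k add_leD1 in blast)+
  have rec: "\<exists>h \<in> configs X s. (topples X s)\<^sup>*\<^sup>* (\<lambda>v. x v + h v) (spread p)"
    if x: "x \<in> stable_configs X s" for x
  proof
    let ?h = "\<lambda>v. ?g v - x v"
    show "?h \<in> configs X s" using spread_in_configs by (auto simp: configs_def)
    \<comment> \<open>The surplus in \<open>?g\<close> is at least the out-degree, so the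
      subtraction in \<open>?h\<close> is exact.\<close>
    have "x v \<le> ?g v" for v
    proof (cases "v \<in> verts X - {s}")
      case True
      then have "x v < out_degree X v" using x by (auto simp: stable_configs_def)
      also have "\<dots> \<le> ?g v"
        using k[of "dist_sink v"] dist_sink_bounds[OF True] out_degree_level[OF True] True
        by (simp add: spread_def)
      finally show ?thesis by simp
    qed (use x in \<open>auto simp: stable_configs_def configs_def\<close>)
    then show "(topples X s)\<^sup>*\<^sup>* (\<lambda>v. x v + ?h v) (spread p)" using g by simp
  qed
  show "group (sandpile_group X s)" "\<one>\<^bsub>sandpile_group X s\<^esub> = spread p"
    by (rule sandpile_group_one[OF pos stable idem rec]; assumption)+
qed

end

text \<open>Asserting \<open>group\<close> as well ensures that the unit is a genuine identity, not
  an unspecified description.\<close>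

theorem theorem6p7:
  fixes X :: "('a, 'b) pre_digraph" and s :: 'a and d :: nat
    and a b c :: "nat \<Rightarrow> nat" and n :: "nat \<Rightarrow> int"
  assumes "sink_distance_regular X s d a b c"
    and "n (d + 1) = 0"
    and "n d = \<lfloor>(real (level_degree a b c d) - 1) / real (c d)\<rfloor>"
    and "\<And>i. 1 \<le> i \<Longrightarrow> i < d \<Longrightarrow>
           n i = \<lfloor>(real (level_degree a b c i) - 1 + real_of_int (n (i + 1)) * real (b i))
                   / real (c i)\<rfloor>"
  shows "group (sandpile_group X s) \<and>
         (\<forall>v. int (\<one>\<^bsub>sandpile_group X s\<^esub> v) =
                (\<Sum>i = 1..d. (n i * int (c i) - n (i + 1) * int (b i)) * int (level_config X s i v)))"
proof -
  interpret distance_regular X s d a b c by unfold_locales (rule assms(1))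
  let ?e = "\<lambda>i. n i * int (c i) - n (i + 1) * int (b i)"
  \<comment> \<open>Since \<open>b d = 0\<close>, the general formula also covers
    \<open>i = d\<close>.\<close>
  have n_floor: "n i = \<lfloor>(real (level_degree a b c i) - 1 + real_of_int (n (i + 1)) * real (b i)) / real (c i)\<rfloor>"
    if "1 \<le> i" "i \<le> d" for i
    using that assms(3,4) b_d by (cases "i = d") auto
  have e_bounds: "int (a i + b i) \<le> ?e i" "?e i < int (level_degree a b c i)"
    if i: "1 \<le> i" "i \<le> d" for i
  proof -
    have n_div: "n i = (int (level_degree a b c i) - 1 + n (i + 1) * int (b i)) div int (c i)"
      using n_floor[OF i] floor_divide_of_int_eq[of "int (level_degree a b c i) - 1 + n (i + 1) * int (b i)" "int (c i)"]
      by simp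
    let ?N = "int (level_degree a b c i) - 1 + n (i + 1) * int (b i)"
    \<comment> \<open>Hence \<open>?e i\<close> is the degree minus 1 minus a remainder below
      \<open>c i\<close>, which gives both bounds.\<close>
    have "?N = n i * int (c i) + ?N mod int (c i)" unfolding n_div by simp
    moreover have "0 \<le> ?N mod int (c i)" "?N mod int (c i) < int (c i)" using c_pos[OF i] by simp_all
    ultimately show "int (a i + b i) \<le> ?e i" "?e i < int (level_degree a b c i)"
      unfolding level_degree_def by linarith+
  qed
  \<comment> \<open>Downward induction from \<open>n (d + 1) = 0\<close>; nonnegativity lets
    \<open>n\<close> serve as a vector of firing numbers.\<close>
  have n_nonneg: "0 \<le> n i" if "1 \<le> i" "i \<le> d + 1" for i
    using that(2,1)
  proof (induction rule: inc_induct)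
    case base
    then show ?case using assms(2) by simp
  next
    case (step m)
    have "0 \<le> ?e m" using e_bounds(1)[of m] step by force
    moreover have "0 \<le> n (m + 1) * int (b m)" using step by simp
    ultimately have "0 \<le> n m * int (c m)" by linarith
    then show ?case using c_pos[of m] step by (simp add: zero_le_mult_iff)
  qed
  define p where "p i = nat (?e i)" for i
  have p: "int (p i) = ?e i" if "1 \<le> i" "i \<le> d" for i
    using e_bounds(1)[OF that] unfolding p_def by simp
  have m: "nat (n i) * c i = p i + nat (n (i + 1)) * b i" if i: "1 \<le> i" "i \<le> d" for i
  proof -
    have "int (nat (n i) * c i) = int (p i + nat (n (i + 1)) * b i)"
      using p[OF i] n_nonneg[of i] n_nonneg[of "i + 1"] i by simp
    then show ?thesis by (simp only: of_nat_eq_iff)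
  qed
  have bounds: "a i + b i \<le> p i" "p i < level_degree a b c i" if "1 \<le> i" "i \<le> d" for i
    using p[OF that] e_bounds[OF that] by linarith+
  have "int (spread p v) = (\<Sum>i = 1..d. ?e i * int (level_config X s i v))" for v
  proof (cases "v \<in> verts X - {s}")
    case True
    have "(\<Sum>i = 1..d. ?e i * int (level_config X s i v)) = (\<Sum>i = 1..d. if i = dist_sink v then ?e i else 0)"
      using True by (intro sum.cong) (auto simp: level_config_def in_level_iff)
    also have "\<dots> = ?e (dist_sink v)" using dist_sink_bounds[OF True] by simp
    finally show ?thesis using True p dist_sink_bounds[OF True] by (simp add: spread_def)
  next
    case False
    then have "v \<notin> level X s i" if "1 \<le> i" for i
      using that dist_sink_eq_0_iff[OF s_in_verts] by (auto simp: in_level_iff)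
    then show ?thesis using False by (auto simp: spread_def level_config_def)
  qed
  then show ?thesis
    using sandpile_group_one_spread[of p "\<lambda>i. nat (n i)", OF bounds m] by simp
qed

end
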